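(* Let $d\ge1$, assume $2-d<q<2$, and let $\mu\in L^\infty(\mathbb T^d)$ be a probability density satisfying $\operatorname*{ess\,inf}_{\mathbb T^d}\mu>0$. Let $K_q$ be the zero-average periodic Riesz kernel on $\mathbb T^d$ with $$\widehat{K_q}(k)=c_{d,q}|2\pi k|^{-d-q},\qquad k\in\mathbb Z^d\setminus\{0\},$$ where $c_{d,q}>0$. Then there exists a sequence of probability densities $\rho_n$ on $\mathbb T^d$, with the same regularity as $\mu$ and in particular smooth if $\mu$ is smooth, such that $$\frac{\displaystyle\int_{\mathbb T^d}|\nabla K_q*(\rho_n-\mu)|^2\rho_n\,\mathrm dx}{\displaystyle\frac12\iint_{(\mathbb T^d)^2}K_q(x-y)(\rho_n-\mu)(x)(\rho_n-\mu)(y)\,\mathrm dx\,\mathrm dy}\longrightarrow0.$$ In particular, no global PL inequality holds for this periodic kernel: there is no finite constant $C$ such that $\frac12\iint K_q(x-y)(\rho-\mu)(x)(\rho-\mu)(y)\,\mathrm dx\,\mathrm dy\le C\int|\nabla K_q*(\rho-\mu)|^2\rho\,\mathrm dx$ for all such probability densities $\rho$ on $\mathbb T^d$.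
   Context: $\mathbb T^d=\mathbb R^d/\mathbb Z^d$ with unit volume; Fourier coefficients are $\widehat f(k)=\int_{\mathbb T^d}e^{-2\pi ik\cdot x}f(x)\,\mathrm dx$; zero-average means $\widehat{K_q}(0)=0$. *)

theory Defs
  imports "HOL-Analysis.Analysis" "HOL-Probability.Essential_Supremum"
begin

text \<open>
  Functions on the torus R^d/Z^d are represented by Z^d-periodic functions on R^d, with d the
  cardinality of the index type. L^p functions are given by Borel representatives. Integrals over
  the torus are integrals over the closed unit cube, which differs from a fundamental domain by
  a null set.
\<close>

definition int_vec :: "int ^ 'n \<Rightarrow> real ^ 'n" where
  "int_vec k = (\<chi> i. real_of_int (k $ i))"

definition torus_measure :: "(real ^ 'n) measure" where
  "torus_measure = restrict_space lborel (cbox 0 One)"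

definition torus_fun :: "(real ^ 'n \<Rightarrow> real) \<Rightarrow> bool" where
  "torus_fun f \<longleftrightarrow> f \<in> borel_measurable borel \<and> (\<forall>x k. f (x + int_vec k) = f x)"

definition torus_L1 :: "(real ^ 'n \<Rightarrow> real) \<Rightarrow> bool" where
  "torus_L1 f \<longleftrightarrow> torus_fun f \<and> integrable torus_measure f"

definition torus_Linf :: "(real ^ 'n \<Rightarrow> real) \<Rightarrow> bool" where
  "torus_Linf f \<longleftrightarrow> torus_fun f \<and> esssup torus_measure (\<lambda>x. ereal \<bar>f x\<bar>) < \<infinity>"

definition torus_essinf :: "(real ^ 'n \<Rightarrow> real) \<Rightarrow> ereal" where
  "torus_essinf f = - esssup torus_measure (\<lambda>x. - ereal (f x))"

definition torus_density :: "(real ^ 'n \<Rightarrow> real) \<Rightarrow> bool" where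
  "torus_density f \<longleftrightarrow>
     torus_L1 f \<and> (AE x in torus_measure. 0 \<le> f x) \<and> (LINT x|torus_measure. f x) = 1"

definition fourier_coeff :: "(real ^ 'n \<Rightarrow> real) \<Rightarrow> int ^ 'n \<Rightarrow> complex" where
  "fourier_coeff f k =
     (LINT x|torus_measure. exp (- 2 * of_real pi * \<i> * of_real (int_vec k \<bullet> x)) * of_real (f x))"

text \<open>The coefficients determine the kernel up to a null set.\<close>

definition periodic_riesz_kernel :: "real \<Rightarrow> real \<Rightarrow> (real ^ 'n \<Rightarrow> real) \<Rightarrow> bool" where
  "periodic_riesz_kernel c q K \<longleftrightarrow>
     torus_L1 K \<and> fourier_coeff K 0 = 0 \<and>
     (\<forall>k. k \<noteq> 0 \<longrightarrow> fourier_coeff K k =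
        of_real (c * norm ((2 * pi) *\<^sub>R int_vec k) powr (- real CARD('n) - q)))"

definition partial_deriv :: "'n \<Rightarrow> (real ^ 'n \<Rightarrow> real) \<Rightarrow> real ^ 'n \<Rightarrow> real" where
  "partial_deriv i f x = frechet_derivative f (at x) (axis i 1)"

definition gradient :: "(real ^ 'n \<Rightarrow> real) \<Rightarrow> real ^ 'n \<Rightarrow> real ^ 'n" where
  "gradient f x = (\<chi> i. partial_deriv i f x)"

primrec C_k :: "nat \<Rightarrow> (real ^ 'n \<Rightarrow> real) \<Rightarrow> bool" where
  "C_k 0 f \<longleftrightarrow> continuous_on UNIV f"
| "C_k (Suc k) f \<longleftrightarrow> (\<forall>x. f differentiable (at x)) \<and> (\<forall>i. C_k k (partial_deriv i f))"

definition smooth :: "(real ^ 'n \<Rightarrow> real) \<Rightarrow> bool" where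
  "smooth f \<longleftrightarrow> (\<forall>k. C_k k f)"

text \<open>
  The last conjunct makes the two functions indistinguishable for every linear regularity scale
  containing the smooth functions (Hoelder, Sobolev, ...).
\<close>

definition same_regularity :: "(real ^ 'n \<Rightarrow> real) \<Rightarrow> (real ^ 'n \<Rightarrow> real) \<Rightarrow> bool" where
  "same_regularity \<mu> \<rho> \<longleftrightarrow>
     (torus_Linf \<mu> \<longleftrightarrow> torus_Linf \<rho>) \<and> (\<forall>k. C_k k \<mu> \<longleftrightarrow> C_k k \<rho>) \<and> smooth (\<lambda>x. \<rho> x - \<mu> x)"

definition torus_conv :: "(real ^ 'n \<Rightarrow> real) \<Rightarrow> (real ^ 'n \<Rightarrow> real) \<Rightarrow> real ^ 'n \<Rightarrow> real" where
  "torus_conv K f x = (LINT y|torus_measure. K (x - y) * f y)"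

definition riesz_energy ::
    "(real ^ 'n \<Rightarrow> real) \<Rightarrow> (real ^ 'n \<Rightarrow> real) \<Rightarrow> (real ^ 'n \<Rightarrow> real) \<Rightarrow> real" where
  "riesz_energy K \<mu> \<rho> = 1 / 2 *
     (LINT (x, y)|(torus_measure \<Otimes>\<^sub>M torus_measure). K (x - y) * (\<rho> x - \<mu> x) * (\<rho> y - \<mu> y))"

text \<open>
  The field \<open>\<nabla>K * f\<close> is the gradient of \<open>K * f\<close>: for q > 1 - d the distributional gradient of the
  Riesz kernel is integrable, so for bounded f the function \<open>K * f\<close> is continuously differentiable.
\<close>

definition riesz_dissipation ::
    "(real ^ 'n \<Rightarrow> real) \<Rightarrow> (real ^ 'n \<Rightarrow> real) \<Rightarrow> (real ^ 'n \<Rightarrow> real) \<Rightarrow> real" where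
  "riesz_dissipation K \<mu> \<rho> =
     (LINT x|torus_measure. (norm (gradient (torus_conv K (\<lambda>y. \<rho> y - \<mu> y)) x))\<^sup>2 * \<rho> x)"

end

theory Submission
  imports Defs "HOL-Probability.Probability_Measure"
begin

text \<open>
  A convolution operator on the torus is diagonal in the Fourier basis, so it suffices to perturb
  \<open>\<mu>\<close> by one real plane wave \<open>f x = a cos (2\<pi> k \<bullet> x)\<close> of high frequency. As the kernel is real with
  the real coefficient \<open>\<kappa>\<close> at \<open>k\<close>, one has \<open>K * f = \<kappa> f\<close> exactly (\<open>torus_conv_plane_wave\<close>). With
  \<open>N = |2\<pi>k|\<close> and \<open>\<kappa> = c * (N powr (-d-q))\<close>, this gives two facts.

  The energy of the perturbation is \<open>\<kappa> a\<^sup>2 / 4\<close>, because \<open>f\<^sup>2\<close> has mean \<open>a\<^sup>2 / 2\<close>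
  (\<open>riesz_energy_plane_wave\<close>).

  The field \<open>\<nabla>K * f\<close> is bounded by \<open>N \<kappa> a\<close>, and the perturbed density has mass one, so the
  dissipation is at most \<open>(N \<kappa> a)\<^sup>2\<close> (\<open>riesz_dissipation_plane_wave_le\<close>).

  The quotient is therefore at most \<open>4 N\<^sup>2 \<kappa> = 4 c * (N powr (2-d-q))\<close>. The
  exponent is negative since \<open>q > 2-d\<close>, and letting \<open>|k|\<close> tend to infinity makes the quotient tend
  to zero. The amplitude \<open>a\<close> stays fixed: any positive \<open>a\<close> below the essential infimum of \<open>\<mu>\<close> keeps the
  perturbed density positive, and a trigonometric perturbation does not change the regularity.

  The Fourier computations rest on the invariance of the torus integral under \<open>y \<mapsto> x - y\<close>
  (\<open>integral_torus_reflect\<close>). It gives the convolution identity, and, applied with \<open>x\<close> equal to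
  half a period, the vanishing mean of a plane wave.
\<close>

section \<open>Invariance of the torus integral under reflections and translations\<close>

definition fundamental_domain :: "(real ^ 'n) set \<Rightarrow> bool" where
  "fundamental_domain Q \<longleftrightarrow> Q \<in> sets borel \<and> (\<forall>z. \<exists>!k. z + int_vec k \<in> Q)"

lemma int_vec_uminus: "int_vec (- k) = - int_vec k"
  by (simp add: int_vec_def vec_eq_iff)

lemma nn_integral_lborel_reflect:
  fixes g :: "'a::euclidean_space \<Rightarrow> ennreal"
  assumes [measurable]: "g \<in> borel_measurable borel"
  shows "(\<integral>\<^sup>+y. g (x - y) \<partial>lborel) = (\<integral>\<^sup>+y. g y \<partial>lborel)"
  by (subst (2) lborel_affine[of "-1" x]) (simp_all add: nn_integral_density nn_integral_distr)

lemma nn_integral_lborel_shift: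
  fixes g :: "'a::euclidean_space \<Rightarrow> ennreal"
  assumes [measurable]: "g \<in> borel_measurable borel"
  shows "(\<integral>\<^sup>+y. g (y + x) \<partial>lborel) = (\<integral>\<^sup>+y. g y \<partial>lborel)"
  by (subst (2) lborel_affine[of 1 x]) (simp_all add: nn_integral_density nn_integral_distr add.commute)

lemma nn_integral_fundamental_domain_translates:
  assumes "fundamental_domain Q"
  shows "(\<integral>\<^sup>+k. indicator Q (z + int_vec k) \<partial>count_space UNIV) = (1::ennreal)"
proof -
  obtain k0 where k0: "\<And>k. z + int_vec k \<in> Q \<longleftrightarrow> k = k0"
    using assms unfolding fundamental_domain_def by metis
  have "(\<lambda>k. indicator Q (z + int_vec k) :: ennreal) = indicator {k0}"
    by (auto simp: fun_eq_iff k0 indicator_def)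
  then show ?thesis by simp
qed

text \<open>
  Cut the domain \<open>P\<close> into its intersections with the integer translates of \<open>Q\<close>. By periodicity of
  \<open>g\<close> each piece can be moved back into \<open>Q\<close> without changing its integral, and the moved pieces
  tile \<open>Q\<close> because the translates of \<open>P\<close> tile the space.
\<close>
lemma nn_integral_fundamental_domain_eq:
  fixes g :: "real ^ 'n \<Rightarrow> ennreal"
  assumes [measurable]: "g \<in> borel_measurable borel"
    and per: "\<And>x k. g (x + int_vec k) = g x"
    and P: "fundamental_domain P" and Q: "fundamental_domain Q"
  shows "(\<integral>\<^sup>+y. g y * indicator P y \<partial>lborel) = (\<integral>\<^sup>+y. g y * indicator Q y \<partial>lborel)"
proof -
  have [measurable]: "P \<in> sets borel" "Q \<in> sets borel"
    using P Q by (auto simp: fundamental_domain_def)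
  have "(\<integral>\<^sup>+y. g y * indicator P y \<partial>lborel)
      = (\<integral>\<^sup>+y. \<integral>\<^sup>+k. g y * indicator P y * indicator Q (y + int_vec k) \<partial>count_space UNIV \<partial>lborel)"
    by (simp add: nn_integral_cmult nn_integral_fundamental_domain_translates[OF Q])
  also have "\<dots> = (\<integral>\<^sup>+k. \<integral>\<^sup>+y. g y * indicator P y * indicator Q (y + int_vec k) \<partial>lborel \<partial>count_space UNIV)"
    by (rule nn_integral_count_space_nn_integral) auto
  also have "\<dots> = (\<integral>\<^sup>+k. \<integral>\<^sup>+y. g y * indicator Q y * indicator P (y + int_vec (- k)) \<partial>lborel \<partial>count_space UNIV)"
  proof (rule nn_integral_cong)
    fix k :: "int ^ 'n"
    have "(\<integral>\<^sup>+y. g y * indicator P y * indicator Q (y + int_vec k) \<partial>lborel)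
        = (\<integral>\<^sup>+y. g (y + int_vec k) * indicator Q (y + int_vec k) * indicator P ((y + int_vec k) + int_vec (- k)) \<partial>lborel)"
      by (simp add: per int_vec_uminus mult_ac)
    also have "\<dots> = (\<integral>\<^sup>+y. g y * indicator Q y * indicator P (y + int_vec (- k)) \<partial>lborel)"
      by (rule nn_integral_lborel_shift) measurable
    finally show "(\<integral>\<^sup>+y. g y * indicator P y * indicator Q (y + int_vec k) \<partial>lborel) = \<dots>" .
  qed
  also have "\<dots> = (\<integral>\<^sup>+y. \<integral>\<^sup>+k. g y * indicator Q y * indicator P (y + int_vec (- k)) \<partial>count_space UNIV \<partial>lborel)"
    by (rule nn_integral_count_space_nn_integral[symmetric]) auto
  also have "\<dots> = (\<integral>\<^sup>+y. g y * indicator Q y * (\<integral>\<^sup>+k. indicator P (y + int_vec (- k)) \<partial>count_space UNIV) \<partial>lborel)"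
    by (simp add: nn_integral_cmult)
  also have "\<dots> = (\<integral>\<^sup>+y. g y * indicator Q y \<partial>lborel)"
  proof -
    have "(\<integral>\<^sup>+k. indicator P (y + int_vec (- k)) \<partial>count_space UNIV) = (1::ennreal)" for y
      using nn_integral_bij_count_space[of uminus UNIV UNIV "\<lambda>k. indicator P (y + int_vec k) :: ennreal"]
      by (simp add: bij_uminus nn_integral_fundamental_domain_translates[OF P])
    then show ?thesis by simp
  qed
  finally show ?thesis .
qed

text \<open>
  The half-open cube, unlike the closed one, meets each class modulo integer vectors exactly once.
\<close>
definition unit_cell :: "(real ^ 'n) set" where
  "unit_cell = {x. \<forall>i. 0 \<le> x $ i \<and> x $ i < 1}"

lemma unit_cell_borel [measurable]: "unit_cell \<in> sets borel"
proof -
  have "(unit_cell :: (real ^ 'n) set) = (\<Inter>i. {x. 0 \<le> x $ i} \<inter> {x. x $ i < 1})"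
    by (auto simp: unit_cell_def)
  also have "\<dots> \<in> sets borel"
    by (intro sets.countable_INT' sets.Int borel_closed borel_open closed_Collect_le open_Collect_less
        continuous_intros) auto
  finally show ?thesis .
qed

lemma fundamental_domain_unit_cell: "fundamental_domain unit_cell"
proof -
  have "z + int_vec k \<in> unit_cell \<longleftrightarrow> k = (\<chi> i. - \<lfloor>z $ i\<rfloor>)" for z and k :: "int ^ 'n"
    unfolding unit_cell_def int_vec_def vec_eq_iff mem_Collect_eq
    by (rule all_cong1) (simp, linarith)
  then show ?thesis unfolding fundamental_domain_def by auto
qed

lemma fundamental_domain_reflect:
  assumes "fundamental_domain Q"
  shows "fundamental_domain {y. x - y \<in> Q}"
proof -
  have Q [measurable]: "Q \<in> sets borel" using assms by (simp add: fundamental_domain_def)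
  have "{y. x - y \<in> Q} \<in> sets borel"
    using measurable_sets_borel[of "\<lambda>y. x - y" borel Q] by (simp add: vimage_def)
  moreover have "\<exists>!k. x - (z + int_vec k) \<in> Q" for z
  proof -
    obtain k0 where k0: "\<And>k. (x - z) + int_vec k \<in> Q \<longleftrightarrow> k = k0"
      using assms unfolding fundamental_domain_def by metis
    have "x - (z + int_vec k) \<in> Q \<longleftrightarrow> k = - k0" for k
      using k0[of "- k"] by (auto simp: int_vec_uminus algebra_simps)
    then show ?thesis by auto
  qed
  ultimately show ?thesis by (simp add: fundamental_domain_def)
qed

lemma mem_unit_cube: "x \<in> cbox 0 One \<longleftrightarrow> (\<forall>i. 0 \<le> x $ i \<and> x $ i \<le> 1)" for x :: "real ^ 'n"
proof -
  have "(One :: real ^ 'n) $ i = 1" for i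
    by (metis Cart_1 one_index)
  then show ?thesis by (simp add: mem_box_cart)
qed

text \<open>The closed cube exceeds the half-open one by finitely many pieces of hyperplanes.\<close>
lemma nn_integral_torus:
  fixes g :: "real ^ 'n \<Rightarrow> ennreal"
  shows "(\<integral>\<^sup>+y. g y \<partial>torus_measure) = (\<integral>\<^sup>+y. g y * indicator unit_cell y \<partial>lborel)"
proof -
  have ae: "AE y in lborel. \<forall>i. (y :: real ^ 'n) $ i \<noteq> 1"
  proof (subst AE_all_countable, rule allI)
    fix i :: 'n
    have "axis i 1 \<in> (Basis :: (real ^ 'n) set)" by simp
    from AE_lborel_inner_neq[OF this, of 1] show "AE y in lborel. (y :: real ^ 'n) $ i \<noteq> 1"
      by (simp add: inner_axis)
  qed
  have "(\<integral>\<^sup>+y. g y \<partial>torus_measure) = (\<integral>\<^sup>+y. g y * indicator (cbox 0 One) y \<partial>lborel)"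
    unfolding torus_measure_def by (rule nn_integral_restrict_space) simp
  also have "\<dots> = (\<integral>\<^sup>+y. g y * indicator unit_cell y \<partial>lborel)"
    using ae by (intro nn_integral_cong_AE, eventually_elim)
      (auto simp: indicator_def mem_unit_cube unit_cell_def less_le)
  finally show ?thesis .
qed

lemma nn_integral_torus_reflect:
  fixes g :: "real ^ 'n \<Rightarrow> ennreal"
  assumes [measurable]: "g \<in> borel_measurable borel"
    and per: "\<And>x k. g (x + int_vec k) = g x"
  shows "(\<integral>\<^sup>+y. g (x - y) \<partial>torus_measure) = (\<integral>\<^sup>+y. g y \<partial>torus_measure)"
proof -
  have "(\<integral>\<^sup>+y. g (x - y) \<partial>torus_measure)
      = (\<integral>\<^sup>+y. g (x - y) * indicator {y. x - y \<in> unit_cell} (x - y) \<partial>lborel)"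
    by (simp add: nn_integral_torus indicator_def)
  also have "\<dots> = (\<integral>\<^sup>+y. g y * indicator {y. x - y \<in> unit_cell} y \<partial>lborel)"
    using fundamental_domain_reflect[OF fundamental_domain_unit_cell, of x]
    by (intro nn_integral_lborel_reflect) (auto simp: fundamental_domain_def)
  also have "\<dots> = (\<integral>\<^sup>+y. g y \<partial>torus_measure)"
    unfolding nn_integral_torus
    by (intro nn_integral_fundamental_domain_eq fundamental_domain_reflect
        fundamental_domain_unit_cell per) simp
  finally show ?thesis .
qed

text \<open>
  The projection to the unit cell. A periodic function factors through it, so an identity between
  image measures under \<open>wrap\<close> transfers the invariance from nonnegative functions to integrals of
  signed functions and to integrability.
\<close>
definition wrap :: "real ^ 'n \<Rightarrow> real ^ 'n" where
  "wrap x = (\<chi> i. frac (x $ i))"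

lemma wrap_borel [measurable]: "wrap \<in> borel_measurable borel"
  unfolding wrap_def
  by (subst borel_measurable_euclidean_space) (auto simp: frac_def Basis_vec_def inner_axis)

lemma wrap_plus_int_vec: "wrap (x + int_vec k) = wrap x"
  by (simp add: wrap_def int_vec_def vec_eq_iff frac_def)

lemma periodic_wrap:
  assumes "\<And>x k. g (x + int_vec k) = g x"
  shows "g (wrap x) = g x"
proof -
  have "x = wrap x + int_vec (\<chi> i. \<lfloor>x $ i\<rfloor>)"
    by (simp add: wrap_def int_vec_def vec_eq_iff frac_def)
  then show ?thesis using assms by metis
qed

lemma space_torus [simp]: "space torus_measure = cbox 0 One"
  by (simp add: torus_measure_def space_restrict_space)

lemma measurable_ident_torus [measurable]: "(\<lambda>x. x) \<in> borel_measurable torus_measure"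
  unfolding torus_measure_def by (rule measurable_restrict_space1) simp

lemma distr_wrap_reflect:
  fixes x :: "real ^ 'n"
  shows "distr torus_measure borel (\<lambda>y. wrap (x - y)) = distr torus_measure borel wrap"
proof (rule measure_eqI)
  fix A :: "(real ^ 'n) set" assume "A \<in> sets (distr torus_measure borel (\<lambda>y. wrap (x - y)))"
  then have [measurable]: "A \<in> sets borel" by simp
  have em: "emeasure (distr torus_measure borel h) A = (\<integral>\<^sup>+y. indicator A (h y) \<partial>torus_measure)"
    if "h \<in> borel_measurable borel" for h :: "real ^ 'n \<Rightarrow> real ^ 'n"
  proof -
    have h: "h \<in> measurable torus_measure borel"
      by (rule measurable_compose[OF measurable_ident_torus that])
    have "emeasure (distr torus_measure borel h) A = (\<integral>\<^sup>+y. indicator A y \<partial>distr torus_measure borel h)"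
      by simp
    also have "\<dots> = (\<integral>\<^sup>+y. indicator A (h y) \<partial>torus_measure)"
      by (subst nn_integral_distr[OF h]) simp_all
    finally show ?thesis .
  qed
  have "(\<integral>\<^sup>+y. indicator A (wrap (x - y)) \<partial>torus_measure)
      = (\<integral>\<^sup>+y. indicator A (wrap y) \<partial>(torus_measure :: (real ^ 'n) measure))"
    by (rule nn_integral_torus_reflect) (measurable, simp add: wrap_plus_int_vec)
  then show "emeasure (distr torus_measure borel (\<lambda>y. wrap (x - y))) A
      = emeasure (distr torus_measure borel wrap) A"
    by (simp add: em)
qed simp

lemma
  fixes g :: "real ^ 'n \<Rightarrow> real"
  assumes "torus_fun g"
  shows integrable_torus_reflect:
      "integrable torus_measure (\<lambda>y. g (x - y)) \<longleftrightarrow> integrable torus_measure g"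
    and integral_torus_reflect:
      "(LINT y|torus_measure. g (x - y)) = (LINT y|torus_measure. g y)"
proof -
  have [measurable]: "g \<in> borel_measurable borel" and per: "\<And>x k. g (x + int_vec k) = g x"
    using assms by (auto simp: torus_fun_def)
  note w = periodic_wrap[of g, OF per]
  have "integrable (distr torus_measure borel (\<lambda>y. wrap (x - y))) g
      \<longleftrightarrow> integrable torus_measure (\<lambda>y. g (x - y))"
    by (subst integrable_distr_eq) (simp_all add: w)
  moreover have "integrable (distr torus_measure borel wrap) g \<longleftrightarrow> integrable torus_measure g"
    by (subst integrable_distr_eq) (simp_all add: w)
  ultimately show "integrable torus_measure (\<lambda>y. g (x - y)) \<longleftrightarrow> integrable torus_measure g"
    by (simp add: distr_wrap_reflect)
  have "integral\<^sup>L (distr torus_measure borel (\<lambda>y. wrap (x - y))) g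
      = (LINT y|torus_measure. g (x - y))"
    by (subst integral_distr) (simp_all add: w)
  moreover have "integral\<^sup>L (distr torus_measure borel wrap) g = (LINT y|torus_measure. g y)"
    by (subst integral_distr) (simp_all add: w)
  ultimately show "(LINT y|torus_measure. g (x - y)) = (LINT y|torus_measure. g y)"
    by (simp add: distr_wrap_reflect)
qed
section \<open>Plane waves\<close>

lemma emeasure_torus: "emeasure (torus_measure :: (real ^ 'n) measure) (cbox 0 One) = 1"
  by (simp add: torus_measure_def emeasure_restrict_space emeasure_lborel_cbox_eq)

lemma prob_space_torus: "prob_space (torus_measure :: (real ^ 'n) measure)"
  by (rule prob_spaceI) (simp add: emeasure_torus)

text \<open>
  The phase is kept general because differentiation shifts it by a quarter turn, so that the
  family is closed under partial derivatives, and because the phase \<open>\<pi> / 2\<close> yields the sine.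
\<close>
definition plane_wave :: "int ^ 'n \<Rightarrow> real \<Rightarrow> real \<Rightarrow> real ^ 'n \<Rightarrow> real" where
  "plane_wave k a \<phi> x = a * cos (2 * pi * (int_vec k \<bullet> x) + \<phi>)"

lemma plane_wave_borel [measurable]: "plane_wave k a \<phi> \<in> borel_measurable borel"
  unfolding plane_wave_def by measurable

lemma abs_plane_wave_le: "\<bar>plane_wave k a \<phi> x\<bar> \<le> \<bar>a\<bar>"
  by (simp add: plane_wave_def abs_mult mult_left_le)

lemma int_vec_inner: "\<exists>n::int. int_vec k \<bullet> int_vec l = of_int n"
  by (rule exI[of _ "\<Sum>i\<in>UNIV. k $ i * l $ i"]) (simp add: int_vec_def inner_vec_def)

lemma torus_fun_plane_wave: "torus_fun (plane_wave k a \<phi>)"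
proof -
  have "plane_wave k a \<phi> (x + int_vec l) = plane_wave k a \<phi> x" for x l
  proof -
    obtain n where n: "int_vec k \<bullet> int_vec l = of_int n" using int_vec_inner by blast
    have "2 * pi * (int_vec k \<bullet> (x + int_vec l)) + \<phi>
        = (2 * pi * (int_vec k \<bullet> x) + \<phi>) + 2 * pi * of_int n"
      by (simp add: inner_add_right n algebra_simps)
    moreover have "cos (t + 2 * pi * of_int n) = cos t" for t :: real
      by (simp add: cos_add)
    ultimately show ?thesis unfolding plane_wave_def by metis
  qed
  then show ?thesis by (simp add: torus_fun_def)
qed

lemma int_vec_eq_0_iff: "int_vec k = 0 \<longleftrightarrow> k = 0"
  by (simp add: int_vec_def vec_eq_iff)

lemma integrable_plane_wave: "integrable torus_measure (plane_wave k a \<phi>)"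
proof -
  interpret prob_space torus_measure by (rule prob_space_torus)
  show ?thesis
    by (rule integrable_const_bound[of _ "\<bar>a\<bar>"]) (simp_all add: abs_plane_wave_le)
qed

text \<open>
  For a vector \<open>v\<close> with \<open>k \<bullet> v = 1 / 2\<close>, the reflection \<open>y \<mapsto> v - y\<close> changes the sign of
  the wave but preserves its integral.
\<close>
lemma integral_plane_wave:
  assumes "k \<noteq> 0"
  shows "(LINT x|torus_measure. plane_wave k a 0 x) = 0"
proof -
  define v where "v = (1 / (2 * (int_vec k \<bullet> int_vec k))) *\<^sub>R int_vec k"
  have v: "int_vec k \<bullet> v = 1 / 2"
    using assms by (simp add: v_def int_vec_eq_0_iff)
  have "plane_wave k a 0 (v - y) = - plane_wave k a 0 y" for y
  proof -
    have "2 * pi * (int_vec k \<bullet> (v - y)) = pi - 2 * pi * (int_vec k \<bullet> y)"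
      by (simp add: inner_diff_right v algebra_simps)
    then show ?thesis by (simp add: plane_wave_def)
  qed
  then have "(LINT y|torus_measure. plane_wave k a 0 y) = - (LINT y|torus_measure. plane_wave k a 0 y)"
    using integral_torus_reflect[OF torus_fun_plane_wave, of k a 0 v] by simp
  then show ?thesis by simp
qed

text \<open>
  The double-angle formula reduces the square to a constant and a wave of frequency \<open>2k\<close>, which
  has mean zero.
\<close>
lemma integral_plane_wave_square:
  assumes "k \<noteq> 0"
  shows "(LINT x|torus_measure. (plane_wave k a 0 x)\<^sup>2) = a\<^sup>2 / 2"
proof -
  interpret prob_space "torus_measure :: (real ^ 'a) measure" by (rule prob_space_torus)
  have "int_vec (k + k) = 2 *\<^sub>R int_vec k"
    by (simp add: int_vec_def vec_eq_iff)
  then have double: "2 * pi * (int_vec (k + k) \<bullet> x) + 0 = 2 * (2 * pi * (int_vec k \<bullet> x) + 0)" for x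
    by simp
  have "(plane_wave k a 0 x)\<^sup>2 = a\<^sup>2 / 2 + plane_wave (k + k) (a\<^sup>2 / 2) 0 x" for x
    unfolding plane_wave_def double cos_double_cos
    by (simp add: power_mult_distrib right_diff_distrib)
  moreover have "k + k \<noteq> 0"
    using assms by (simp add: vec_eq_iff)
  ultimately show ?thesis
    using prob_space by (simp add: integrable_plane_wave integral_plane_wave)
qed

lemma plane_wave_has_derivative:
  "(plane_wave k a \<phi> has_derivative
     (\<lambda>h. - a * sin (2 * pi * (int_vec k \<bullet> x) + \<phi>) * (2 * pi * (int_vec k \<bullet> h)))) (at x)"
  unfolding plane_wave_def by (auto intro!: derivative_eq_intros)

lemma partial_deriv_plane_wave:
  "partial_deriv i (plane_wave k a \<phi>) = plane_wave k (2 * pi * real_of_int (k $ i) * a) (\<phi> + pi / 2)"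
proof
  fix x
  show "partial_deriv i (plane_wave k a \<phi>) x
      = plane_wave k (2 * pi * real_of_int (k $ i) * a) (\<phi> + pi / 2) x"
    unfolding partial_deriv_def frechet_derivative_at[OF plane_wave_has_derivative, symmetric]
    by (simp add: plane_wave_def inner_axis int_vec_def add.assoc[symmetric] cos_add)
qed

lemma gradient_plane_wave:
  "gradient (plane_wave k a 0) x
    = (- a * sin (2 * pi * (int_vec k \<bullet> x))) *\<^sub>R ((2 * pi) *\<^sub>R int_vec k)"
  by (simp add: gradient_def partial_deriv_plane_wave vec_eq_iff plane_wave_def cos_add)
     (simp add: int_vec_def)

lemma C_k_plane_wave: "C_k m (plane_wave k a \<phi>)"
proof (induction m arbitrary: a \<phi>)
  case 0
  show ?case unfolding C_k.simps plane_wave_def by (intro continuous_intros)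
next
  case (Suc m)
  have "plane_wave k a \<phi> differentiable (at x)" for x
    using plane_wave_has_derivative differentiable_def by blast
  with Suc show ?case by (simp add: partial_deriv_plane_wave)
qed

section \<open>Convolution, energy and dissipation of a plane wave\<close>

text \<open>
  After the substitution \<open>y \<mapsto> x - y\<close> and the addition theorem for the cosine, the convolution is a
  combination of the cosine and sine moments of \<open>K\<close>. These are the real part and, up to sign, the
  imaginary part of the Fourier coefficient, hence \<open>\<kappa>\<close> and \<open>0\<close>.
\<close>
lemma torus_conv_plane_wave:
  assumes K: "torus_L1 K" and Kk: "fourier_coeff K k = of_real \<kappa>"
  shows "torus_conv K (plane_wave k a 0) = plane_wave k (\<kappa> * a) 0"
proof
  fix x
  let ?\<theta> = "\<lambda>y. 2 * pi * (int_vec k \<bullet> y)"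
  have Kb [measurable]: "K \<in> borel_measurable borel" and Ki: "integrable torus_measure K"
    and per: "\<And>x l. K (x + int_vec l) = K x"
    using K by (auto simp: torus_L1_def torus_fun_def)
  have int: "integrable torus_measure (\<lambda>y. K y * plane_wave k b \<phi> y)" for b \<phi>
    by (rule Bochner_Integration.integrable_bound[OF integrable_mult_right[OF Ki, of b]])
       (auto simp: abs_mult intro!: AE_I2 mult_right_mono[OF abs_plane_wave_le] simp: mult.commute[of "K _"])
  let ?e = "\<lambda>y. exp (- 2 * of_real pi * \<i> * of_real (int_vec k \<bullet> y)) * complex_of_real (K y)"
  have e: "Re (?e y) = K y * plane_wave k 1 0 y" "Im (?e y) = K y * plane_wave k 1 (pi / 2) y" for y
    by (simp_all add: plane_wave_def Re_exp Im_exp cos_add mult.commute)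
  have ei: "integrable torus_measure ?e"
    by (rule Bochner_Integration.integrable_bound[OF Ki]) (auto simp: norm_mult)
  have c: "(LINT y|torus_measure. K y * plane_wave k 1 0 y) = \<kappa>"
    using integral_Re[OF ei] Kk[unfolded fourier_coeff_def] unfolding e by simp
  have s: "(LINT y|torus_measure. K y * plane_wave k 1 (pi / 2) y) = 0"
    using integral_Im[OF ei] Kk[unfolded fourier_coeff_def] unfolding e by simp
  define g where "g z = K z * plane_wave k a 0 (x - z)" for z
  have g: "g z = a * cos (?\<theta> x) * (K z * plane_wave k 1 0 z)
      - a * sin (?\<theta> x) * (K z * plane_wave k 1 (pi / 2) z)" for z
    by (simp add: g_def plane_wave_def inner_diff_right right_diff_distrib cos_diff cos_add algebra_simps)
  have "g \<in> borel_measurable borel"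
    unfolding g_def[abs_def] by measurable
  then have "torus_fun g"
    using torus_fun_plane_wave[of k 1] by (auto simp: torus_fun_def g per)
  then have "(LINT y|torus_measure. g (x - y)) = (LINT y|torus_measure. g y)"
    by (rule integral_torus_reflect)
  also have "\<dots> = a * cos (?\<theta> x) * \<kappa>"
    unfolding g by (subst Bochner_Integration.integral_diff) (simp_all add: int c s)
  finally show "torus_conv K (plane_wave k a 0) x = plane_wave k (\<kappa> * a) 0 x"
    by (simp add: torus_conv_def g_def plane_wave_def mult_ac)
qed

text \<open>
  Fubini turns the double integral into the integral of \<open>f\<close> times \<open>K * f = \<kappa> f\<close>. The theorem
  applies because \<open>f\<close> is bounded and \<open>K (x - y)\<close> is integrable on the product: its absolute value
  has, by invariance, the same integral in \<open>y\<close> for every \<open>x\<close>.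
\<close>
lemma riesz_energy_plane_wave:
  assumes K: "torus_L1 K" and Kk: "fourier_coeff K k = of_real \<kappa>" and "k \<noteq> 0"
  shows "riesz_energy K \<mu> (\<lambda>x. \<mu> x + plane_wave k a 0 x) = \<kappa> * a\<^sup>2 / 4"
proof -
  let ?T = "torus_measure :: (real ^ 'a) measure"
  let ?f = "plane_wave k a 0"
  interpret prob_space ?T by (rule prob_space_torus)
  interpret pair_sigma_finite ?T ?T ..
  have Kb [measurable]: "K \<in> borel_measurable borel" and Ki: "integrable ?T K" and Kt: "torus_fun K"
    using K by (auto simp: torus_L1_def torus_fun_def)
  have Kxi: "integrable ?T (\<lambda>y. K (x - y))" for x
    using integrable_torus_reflect[OF Kt] Ki by simp
  have Ka: "torus_fun (\<lambda>x. \<bar>K x\<bar>)" using Kt by (auto simp: torus_fun_def)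
  have "integrable (?T \<Otimes>\<^sub>M ?T) (\<lambda>z. K (fst z - snd z))"
    by (rule Fubini_integrable) (simp_all add: Kxi integral_torus_reflect[OF Ka])
  then have int: "integrable (?T \<Otimes>\<^sub>M ?T) (\<lambda>z. K (fst z - snd z) * ?f (fst z) * ?f (snd z))"
  proof (rule Bochner_Integration.integrable_bound[OF integrable_mult_right[of "a\<^sup>2"]])
    show "AE z in ?T \<Otimes>\<^sub>M ?T. norm (K (fst z - snd z) * ?f (fst z) * ?f (snd z))
        \<le> norm (a\<^sup>2 * K (fst z - snd z))"
    proof (rule AE_I2)
      fix z :: "(real ^ 'a) \<times> (real ^ 'a)"
      have "\<bar>?f (fst z)\<bar> * \<bar>?f (snd z)\<bar> \<le> \<bar>a\<bar> * \<bar>a\<bar>"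
        by (intro mult_mono abs_plane_wave_le) auto
      from mult_left_mono[OF this, of "\<bar>K (fst z - snd z)\<bar>"]
      show "norm (K (fst z - snd z) * ?f (fst z) * ?f (snd z)) \<le> norm (a\<^sup>2 * K (fst z - snd z))"
        by (simp only: real_norm_def abs_mult power2_eq_square mult_ac)
    qed
  qed measurable
  have "(LINT z|(?T \<Otimes>\<^sub>M ?T). K (fst z - snd z) * ?f (fst z) * ?f (snd z))
      = (LINT x|?T. LINT y|?T. K (x - y) * ?f x * ?f y)"
    using integral_fst'[OF int] by simp
  also have "\<dots> = (LINT x|?T. ?f x * torus_conv K ?f x)"
    unfolding torus_conv_def
    by (intro Bochner_Integration.integral_cong refl) (simp flip: integral_mult_right_zero add: mult_ac)
  also have "\<dots> = (LINT x|?T. \<kappa> * (?f x)\<^sup>2)"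
    unfolding torus_conv_plane_wave[OF K Kk]
    by (intro Bochner_Integration.integral_cong refl) (simp add: plane_wave_def power2_eq_square mult_ac)
  also have "\<dots> = \<kappa> * a\<^sup>2 / 2"
    by (simp add: integral_plane_wave_square[OF \<open>k \<noteq> 0\<close>])
  finally show ?thesis
    by (simp add: riesz_energy_def case_prod_unfold)
qed

text \<open>
  The gradient of \<open>K * f = \<kappa> f\<close> is bounded uniformly in \<open>x\<close>, and integrating a constant against a
  probability density returns that constant.
\<close>
lemma riesz_dissipation_plane_wave_le:
  assumes K: "torus_L1 K" and Kk: "fourier_coeff K k = of_real \<kappa>"
    and \<rho>: "torus_density (\<lambda>x. \<mu> x + plane_wave k a 0 x)"
  shows "riesz_dissipation K \<mu> (\<lambda>x. \<mu> x + plane_wave k a 0 x)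
    \<le> (norm ((2 * pi) *\<^sub>R int_vec k) * \<kappa> * a)\<^sup>2" (is "_ \<le> ?B")
proof -
  let ?\<rho> = "\<lambda>x. \<mu> x + plane_wave k a 0 x"
  have int: "integrable torus_measure ?\<rho>" and pos: "AE x in torus_measure. 0 \<le> ?\<rho> x"
    and one: "(LINT x|torus_measure. ?\<rho> x) = 1"
    using \<rho> by (auto simp: torus_density_def torus_L1_def)
  have B: "(norm (gradient (plane_wave k (\<kappa> * a) 0) x))\<^sup>2 \<le> ?B" for x
  proof -
    have "norm (gradient (plane_wave k (\<kappa> * a) 0) x)
        = \<bar>sin (2 * pi * (int_vec k \<bullet> x))\<bar> * \<bar>norm ((2 * pi) *\<^sub>R int_vec k) * \<kappa> * a\<bar>"
      unfolding gradient_plane_wave norm_scaleR by (simp add: abs_mult)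
    also have "\<dots> \<le> \<bar>norm ((2 * pi) *\<^sub>R int_vec k) * \<kappa> * a\<bar>"
      by (intro mult_left_le_one_le) auto
    finally show ?thesis by (metis abs_norm_cancel abs_le_square_iff)
  qed
  have "(LINT x|torus_measure. (norm (gradient (plane_wave k (\<kappa> * a) 0) x))\<^sup>2 * ?\<rho> x)
      \<le> (LINT x|torus_measure. ?B * ?\<rho> x)"
  proof (rule integral_mono_AE'[OF integrable_mult_right[OF int]])
    show "AE x in torus_measure.
        (norm (gradient (plane_wave k (\<kappa> * a) 0) x))\<^sup>2 * ?\<rho> x \<le> ?B * ?\<rho> x"
      using pos by (rule eventually_mono) (rule mult_right_mono[OF B])
    show "AE x in torus_measure. 0 \<le> ?B * ?\<rho> x"
      using pos by (rule eventually_mono) (rule mult_nonneg_nonneg[OF zero_le_power2])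
  qed
  also have "\<dots> = ?B" using one by simp
  finally show ?thesis
    by (simp add: riesz_dissipation_def torus_conv_plane_wave[OF K Kk])
qed

lemma riesz_dissipation_nonneg:
  assumes "torus_density \<rho>" shows "0 \<le> riesz_dissipation K \<mu> \<rho>"
  unfolding riesz_dissipation_def
  using assms by (intro integral_nonneg_AE) (auto simp: torus_density_def elim!: eventually_mono)

section \<open>Perturbing a density by a plane wave\<close>

lemma C_k_add: "C_k m f \<Longrightarrow> C_k m g \<Longrightarrow> C_k m (\<lambda>x. f x + g x)"
proof (induction m arbitrary: f g)
  case 0
  then show ?case by (simp add: continuous_on_add)
next
  case (Suc m)
  have "partial_deriv i (\<lambda>x. f x + g x) = (\<lambda>x. partial_deriv i f x + partial_deriv i g x)" for i
  proof
    fix x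
    have "((\<lambda>x. f x + g x) has_derivative
        (\<lambda>h. frechet_derivative f (at x) h + frechet_derivative g (at x) h)) (at x)"
      using Suc.prems by (intro has_derivative_add) (simp_all add: frechet_derivative_works)
    from frechet_derivative_at[OF this]
    show "partial_deriv i (\<lambda>x. f x + g x) x = partial_deriv i f x + partial_deriv i g x"
      unfolding partial_deriv_def by metis
  qed
  with Suc show ?case by (simp add: differentiable_add)
qed

lemma C_k_add_plane_wave_iff: "C_k m (\<lambda>x. f x + plane_wave k a \<phi> x) \<longleftrightarrow> C_k m f"
proof
  assume "C_k m (\<lambda>x. f x + plane_wave k a \<phi> x)"
  from C_k_add[OF this C_k_plane_wave[of m k "- a" \<phi>]] show "C_k m f"
    by (simp add: plane_wave_def)
qed (simp add: C_k_add C_k_plane_wave)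

lemma AE_torus_essinf_le: "AE x in torus_measure. torus_essinf f \<le> ereal (f x)"
  using esssup_AE[of "\<lambda>x. - ereal (f x)" torus_measure]
  by (rule eventually_mono) (auto simp: torus_essinf_def ereal_uminus_le_reorder)

lemma torus_essinf_geI:
  assumes "torus_fun f" and "AE x in torus_measure. b \<le> f x"
  shows "ereal b \<le> torus_essinf f"
proof -
  have [measurable]: "f \<in> borel_measurable borel" using assms by (simp add: torus_fun_def)
  have "esssup torus_measure (\<lambda>x. - ereal (f x)) \<le> - ereal b"
    using assms(2) by (intro esssup_I) (auto elim!: eventually_mono)
  then show ?thesis
    unfolding torus_essinf_def by (metis ereal_minus_le_minus ereal_uminus_uminus)
qed

lemma torus_Linf_add:
  assumes "torus_Linf f" "torus_Linf g"
  shows "torus_Linf (\<lambda>x. f x + g x)"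
proof -
  have f: "torus_fun f" "esssup torus_measure (\<lambda>x. ereal \<bar>f x\<bar>) < \<infinity>"
    and g: "torus_fun g" "esssup torus_measure (\<lambda>x. ereal \<bar>g x\<bar>) < \<infinity>"
    using assms by (auto simp: torus_Linf_def)
  have [measurable]: "f \<in> borel_measurable borel" "g \<in> borel_measurable borel"
    using f g by (auto simp: torus_fun_def)
  have "esssup torus_measure (\<lambda>x. ereal \<bar>f x + g x\<bar>)
      \<le> esssup torus_measure (\<lambda>x. ereal \<bar>f x\<bar> + ereal \<bar>g x\<bar>)"
    by (intro esssup_mono) auto
  also have "\<dots> \<le> esssup torus_measure (\<lambda>x. ereal \<bar>f x\<bar>) + esssup torus_measure (\<lambda>x. ereal \<bar>g x\<bar>)"
    by (rule esssup_add)
  also have "\<dots> < \<infinity>" using f(2) g(2) by simp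
  finally show ?thesis using f g by (auto simp: torus_Linf_def torus_fun_def)
qed

lemma torus_Linf_plane_wave: "torus_Linf (plane_wave k a \<phi>)"
proof -
  have "esssup torus_measure (\<lambda>x. ereal \<bar>plane_wave k a \<phi> x\<bar>) \<le> ereal \<bar>a\<bar>"
    by (intro esssup_I) (auto simp: abs_plane_wave_le)
  then show ?thesis by (auto simp: torus_Linf_def torus_fun_plane_wave)
qed

lemma torus_density_add_plane_wave:
  assumes \<mu>: "torus_density \<mu>" and lb: "AE x in torus_measure. \<bar>a\<bar> \<le> \<mu> x" and "k \<noteq> 0"
  shows "torus_density (\<lambda>x. \<mu> x + plane_wave k a 0 x)"
proof -
  have "0 \<le> \<mu> x + plane_wave k a 0 x" if "\<bar>a\<bar> \<le> \<mu> x" for x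
    using that abs_plane_wave_le[of k a 0 x] by linarith
  with lb have "AE x in torus_measure. 0 \<le> \<mu> x + plane_wave k a 0 x"
    by (auto elim: eventually_mono)
  with \<mu> torus_fun_plane_wave[of k a 0] show ?thesis
    by (auto simp: torus_density_def torus_L1_def torus_fun_def integrable_plane_wave
        integral_plane_wave[OF \<open>k \<noteq> 0\<close>])
qed

lemma same_regularity_add_plane_wave:
  assumes "torus_Linf \<mu>"
  shows "same_regularity \<mu> (\<lambda>x. \<mu> x + plane_wave k a \<phi> x)"
  using assms torus_Linf_add[OF assms torus_Linf_plane_wave]
  by (simp add: same_regularity_def C_k_add_plane_wave_iff smooth_def C_k_plane_wave)

section \<open>High frequencies defeat the PL inequality\<close>

theorem proposition6p4:
  fixes c q :: real and \<mu> K :: "real ^ 'n \<Rightarrow> real"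
  assumes "2 - real CARD('n) < q" and "q < 2"
    and "torus_density \<mu>" and "torus_Linf \<mu>" and "0 < torus_essinf \<mu>"
    and "0 < c" and "periodic_riesz_kernel c q K"
  shows "(\<exists>\<rho> :: nat \<Rightarrow> real ^ 'n \<Rightarrow> real.
            (\<forall>n. torus_density (\<rho> n) \<and> same_regularity \<mu> (\<rho> n)
                 \<and> (smooth \<mu> \<longrightarrow> smooth (\<rho> n)) \<and> 0 < riesz_energy K \<mu> (\<rho> n))
            \<and> (\<lambda>n. riesz_dissipation K \<mu> (\<rho> n) / riesz_energy K \<mu> (\<rho> n)) \<longlonglongrightarrow> 0)
       \<and> \<not> (\<exists>C :: real. \<forall>\<rho>. torus_density \<rho> \<and> torus_Linf \<rho> \<and> 0 < torus_essinf \<rho> \<and> same_regularity \<mu> \<rho>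
              \<longrightarrow> riesz_energy K \<mu> \<rho> \<le> C * riesz_dissipation K \<mu> \<rho>)"
proof -
  obtain b where b: "0 < b" "ereal b < torus_essinf \<mu>"
    using ereal_dense2[OF \<open>0 < torus_essinf \<mu>\<close>] by auto
  have lb: "AE x in torus_measure. b \<le> \<mu> x"
    using AE_torus_essinf_le[of \<mu>]
    by (rule eventually_mono) (use b in \<open>meson ereal_less_eq(3) less_le_trans order_less_imp_le\<close>)
  \<comment> \<open>Half the lower bound, so that the perturbed densities still have a positive essential infimum,
    as the second claim requires.\<close>
  define a where "a = b / 2"
  have a: "0 < a" "AE x in torus_measure. \<bar>a\<bar> \<le> \<mu> x"
    using b lb by (auto simp: a_def elim!: eventually_mono)
  fix i0 :: 'n
  define k :: "nat \<Rightarrow> int ^ 'n" where "k n = axis i0 (int (Suc n))" for n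
  define N where "N n = norm ((2 * pi) *\<^sub>R int_vec (k n))" for n
  define \<kappa> where "\<kappa> n = c * N n powr (- real CARD('n) - q)" for n
  define \<rho> where "\<rho> n = (\<lambda>x. \<mu> x + plane_wave (k n) a 0 x)" for n
  have k0: "k n \<noteq> 0" for n by (simp add: k_def axis_eq_0_iff)
  have "int_vec (k n) = real (Suc n) *\<^sub>R axis i0 1" for n
    by (simp add: int_vec_def k_def vec_eq_iff axis_def)
  then have N: "N n = 2 * pi * real (Suc n)" for n by (simp add: N_def norm_axis_1)
  have Npos: "0 < N n" for n unfolding N by simp
  have \<kappa>: "0 < \<kappa> n" for n using Npos[of n] \<open>0 < c\<close> by (simp add: \<kappa>_def)
  have K: "torus_L1 K" and Kk: "fourier_coeff K (k n) = of_real (\<kappa> n)" for n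
    using \<open>periodic_riesz_kernel c q K\<close> k0 by (auto simp: periodic_riesz_kernel_def \<kappa>_def N_def)
  have dens: "torus_density (\<rho> n)" for n
    unfolding \<rho>_def using torus_density_add_plane_wave[OF \<open>torus_density \<mu>\<close> a(2) k0] .
  have reg: "same_regularity \<mu> (\<rho> n)" for n
    unfolding \<rho>_def by (rule same_regularity_add_plane_wave) fact
  have energy: "riesz_energy K \<mu> (\<rho> n) = \<kappa> n * a\<^sup>2 / 4" for n
    unfolding \<rho>_def by (rule riesz_energy_plane_wave[OF K Kk k0])
  have epos: "0 < riesz_energy K \<mu> (\<rho> n)" for n
    using \<kappa> a by (simp add: energy)
  have diss: "riesz_dissipation K \<mu> (\<rho> n) \<le> (N n * \<kappa> n * a)\<^sup>2" for n
    unfolding \<rho>_def N_def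
    by (rule riesz_dissipation_plane_wave_le[OF K Kk dens[unfolded \<rho>_def]])
  have ratio: "riesz_dissipation K \<mu> (\<rho> n) / riesz_energy K \<mu> (\<rho> n)
      \<le> 4 * c * N n powr (2 - real CARD('n) - q)" for n
  proof -
    have "riesz_dissipation K \<mu> (\<rho> n) / riesz_energy K \<mu> (\<rho> n)
        \<le> (N n * \<kappa> n * a)\<^sup>2 / (\<kappa> n * a\<^sup>2 / 4)"
      using diss[of n] epos[of n] by (simp add: energy divide_right_mono)
    also have "\<dots> = 4 * (N n)\<^sup>2 * \<kappa> n"
      using a \<kappa>[of n] by (simp add: field_simps power2_eq_square)
    also have "\<dots> = 4 * c * (N n powr 2 * N n powr (- real CARD('n) - q))"
      using Npos[of n] by (simp add: \<kappa>_def powr_numeral)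
    also have "\<dots> = 4 * c * N n powr (2 - real CARD('n) - q)"
      by (simp flip: powr_add) (simp add: algebra_simps)
    finally show ?thesis .
  qed
  have Nlim: "filterlim N at_top sequentially"
    unfolding N
    by (intro filterlim_tendsto_pos_mult_at_top[OF tendsto_const]
        filterlim_compose[OF filterlim_real_sequentially filterlim_Suc]) simp
  have "(\<lambda>n. 4 * c * N n powr (2 - real CARD('n) - q)) \<longlonglongrightarrow> 4 * c * 0"
    using \<open>2 - real CARD('n) < q\<close>
    by (intro tendsto_mult_left tendsto_neg_powr Nlim) simp
  then have upper: "(\<lambda>n. 4 * c * N n powr (2 - real CARD('n) - q)) \<longlonglongrightarrow> 0"
    by (simp only: mult_zero_right)
  have lim: "(\<lambda>n. riesz_dissipation K \<mu> (\<rho> n) / riesz_energy K \<mu> (\<rho> n)) \<longlonglongrightarrow> 0"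
  proof (rule real_tendsto_sandwich[OF _ _ tendsto_const upper])
    show "\<forall>\<^sub>F n in sequentially. 0 \<le> riesz_dissipation K \<mu> (\<rho> n) / riesz_energy K \<mu> (\<rho> n)"
      by (intro always_eventually allI divide_nonneg_pos riesz_dissipation_nonneg dens epos)
    show "\<forall>\<^sub>F n in sequentially. riesz_dissipation K \<mu> (\<rho> n) / riesz_energy K \<mu> (\<rho> n)
        \<le> 4 * c * N n powr (2 - real CARD('n) - q)"
      by (intro always_eventually allI ratio)
  qed
  have "\<not> (\<forall>\<rho>. torus_density \<rho> \<and> torus_Linf \<rho> \<and> 0 < torus_essinf \<rho> \<and> same_regularity \<mu> \<rho>
              \<longrightarrow> riesz_energy K \<mu> \<rho> \<le> C * riesz_dissipation K \<mu> \<rho>)" for C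
  proof
    assume PL: "\<forall>\<rho>. torus_density \<rho> \<and> torus_Linf \<rho> \<and> 0 < torus_essinf \<rho> \<and> same_regularity \<mu> \<rho>
              \<longrightarrow> riesz_energy K \<mu> \<rho> \<le> C * riesz_dissipation K \<mu> \<rho>"
    have "1 \<le> C * (riesz_dissipation K \<mu> (\<rho> n) / riesz_energy K \<mu> (\<rho> n))" for n
    proof -
      have "a \<le> \<rho> n x" if "b \<le> \<mu> x" for x
        using that abs_plane_wave_le[of "k n" a 0 x] b by (auto simp: \<rho>_def a_def)
      then have "AE x in torus_measure. a \<le> \<rho> n x"
        using lb by (auto elim: eventually_mono)
      then have "ereal a \<le> torus_essinf (\<rho> n)"
        using dens[of n] by (intro torus_essinf_geI) (auto simp: torus_density_def torus_L1_def)
      then have "0 < torus_essinf (\<rho> n)"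
        using a(1) by (metis ereal_less(2) less_le_trans)
      moreover have "torus_Linf (\<rho> n)"
        using reg[of n] \<open>torus_Linf \<mu>\<close> by (simp add: same_regularity_def)
      ultimately show ?thesis
        using PL dens reg epos[of n] by (simp add: field_simps)
    qed
    then have "1 \<le> C * 0"
      by (intro LIMSEQ_le_const[OF tendsto_mult_left[OF lim]]) auto
    then show False by simp
  qed
  moreover have "smooth \<mu> \<longrightarrow> smooth (\<rho> n)" for n
    using reg[of n] by (simp add: same_regularity_def smooth_def)
  ultimately show ?thesis
    using dens reg epos lim by blast
qed

end
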